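(* For every integer $k\ge 2$, the commutator width of the group $Syl_2 A_{2^k}$ is equal to $1$: $cw(Syl_2 A_{2^k})=1$.
   Context: $Syl_2 A_{2^k}$ denotes a Sylow 2-subgroup of the alternating group $A_{2^k}$. Notation: $[a,b]=aba^{-1}b^{-1}$, and $G'=[G,G]$ is the derived subgroup of a group $G$. The commutator length of $g\in G'$ is the minimal $n$ such that there exist $x_1,\dots,x_n,y_1,\dots,y_n\in G$ with $g=[x_1,y_1]\cdots[x_n,y_n]$; the commutator length of the identity element is $0$. The commutator width $cw(G)$ is the maximum of the commutator lengths of the elements of $G'$.
   Formalization: For k = 2 the group Syl_2 A_4 is the Klein four-group, which is abelian, so its commutator width is 0 and not 1; the formal statement asserts width 0 for k = 2 and width 1 for every k ≥ 3. *)

theory Defs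
  imports
    "HOL-Algebra.Sym_Groups"
    "HOL-Computational_Algebra.Primes"
begin

definition sylow_subgroup :: "nat \<Rightarrow> 'a set \<Rightarrow> ('a, 'b) monoid_scheme \<Rightarrow> bool"
  where "sylow_subgroup p P G \<longleftrightarrow>
    subgroup P G \<and> card P = p ^ multiplicity p (order G)"

definition commutator :: "('a, 'b) monoid_scheme \<Rightarrow> 'a \<Rightarrow> 'a \<Rightarrow> 'a"
  where "commutator G x y = x \<otimes>\<^bsub>G\<^esub> y \<otimes>\<^bsub>G\<^esub> inv\<^bsub>G\<^esub> x \<otimes>\<^bsub>G\<^esub> inv\<^bsub>G\<^esub> y"

(* The empty product is the identity, so the identity has commutator length 0.
   Only meaningful for g in the derived subgroup. *)
definition commutator_length :: "('a, 'b) monoid_scheme \<Rightarrow> 'a \<Rightarrow> nat"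
  where "commutator_length G g =
    (LEAST n. \<exists>xys. length xys = n \<and> set xys \<subseteq> carrier G \<times> carrier G \<and>
       g = foldr (\<lambda>(x, y) h. commutator G x y \<otimes>\<^bsub>G\<^esub> h) xys \<one>\<^bsub>G\<^esub>)"

(* Max is only specified on finite nonempty sets, so this is to be used for
   groups in which the commutator lengths are bounded, e.g. finite groups. *)
definition commutator_width :: "('a, 'b) monoid_scheme \<Rightarrow> nat"
  where "commutator_width G = Max (commutator_length G ` derived G (carrier G))"

end

(* Let W_k be the Sylow 2-subgroup of Sym(2^k), that is, the k-fold iterated wreath product of C_2,
   and E_k its subgroup of even permutations. By Sylow's conjugacy theorem P is isomorphic to E_k.
   Write an element of W_{k+1} as (g, h) s^e, where s swaps the two halves; then
     [(1, y) s, (u, g u)] = (g, [y, u] g^-1).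
   By induction, every element of W_k whose level parities all vanish is a commutator [y, u] with
   y even: (g, h) has this form as soon as h g = [y, u] does, and (1, y) s is even since y is.
   An element of the derived subgroup of E_{k+1} is a pair (g, h) with g and h even such that all
   level parities of h g vanish. So h g = [y, u] with y even, and then (1, y) s and (u, g u) both
   lie in E_{k+1}. For k = 2 the group is abelian, while for k > 2 it is not. *)
theory Submission
  imports Defs "HOL-Algebra.Group_Action"
begin

section \<open>Conjugacy of Sylow subgroups\<close>

text \<open>The inverse turns right multiplication into a left action, and the restriction to
  \<open>rcosets P\<close> makes each map extensional, as \<open>Bij\<close> demands.\<close>

lemma (in group) action_on_rcosets:
  assumes "subgroup H G" "subgroup P G"
  shows "group_action (G\<lparr>carrier := H\<rparr>) (rcosets P) (\<lambda>h. \<lambda>R \<in> rcosets P. R #> inv h)"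
proof -
  interpret H: subgroup H G by fact
  interpret P: subgroup P G by fact
  have closed: "R #> x \<in> rcosets P" if "R \<in> rcosets P" "x \<in> carrier G" for R x
    using that P.subset by (auto simp: RCOSETS_def coset_mult_assoc)
  have assoc: "R #> x #> y = R #> (x \<otimes> y)"
    if "R \<in> rcosets P" "x \<in> carrier G" "y \<in> carrier G" for R x y
    using that P.rcosets_carrier[OF _ that(1)] is_group by (simp add: coset_mult_assoc)
  have one: "R #> \<one> = R" if "R \<in> rcosets P" for R
    using that P.rcosets_carrier[OF _ that(1)] is_group by simp
  have bij: "(\<lambda>R \<in> rcosets P. R #> inv h) \<in> Bij (rcosets P)" if "h \<in> carrier G" for h
  proof -
    have "bij_betw (\<lambda>R \<in> rcosets P. R #> inv h) (rcosets P) (rcosets P)"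
      by (rule bij_betwI[where g = "\<lambda>R. R #> h"]) (auto simp: that closed assoc one)
    thus ?thesis by (auto simp: Bij_def)
  qed
  show ?thesis
    unfolding group_action_def group_hom_def group_hom_axioms_def hom_def
  proof (intro conjI CollectI ballI)
    fix g h assume "g \<in> carrier (G\<lparr>carrier := H\<rparr>)" "h \<in> carrier (G\<lparr>carrier := H\<rparr>)"
    hence gh: "g \<in> carrier G" "h \<in> carrier G" by auto
    thus "(\<lambda>R\<in>rcosets P. R #> inv (g \<otimes>\<^bsub>G\<lparr>carrier := H\<rparr>\<^esub> h)) =
        (\<lambda>R\<in>rcosets P. R #> inv g) \<otimes>\<^bsub>BijGroup (rcosets P)\<^esub> (\<lambda>R\<in>rcosets P. R #> inv h)"
      by (auto simp: BijGroup_def bij compose_def fun_eq_iff closed assoc inv_mult_group)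
  qed (use bij in \<open>auto simp: BijGroup_def group_BijGroup[unfolded BijGroup_def] subgroup_imp_group[OF assms(1)]\<close>)
qed

text \<open>All orbits have \<open>p\<close>-power size, so an orbit whose size is prime to \<open>p\<close> is a singleton.\<close>

lemma (in group_action) fixed_point_of_prime_power:
  assumes "finite E" "Factorial_Ring.prime p" "order G = p ^ n" "\<not> p dvd card E"
  shows "\<exists>x\<in>E. \<forall>g\<in>carrier G. \<phi> g x = x"
proof -
  interpret group G using group_hom group_hom.axioms(1) by blast
  have "card E = (\<Sum>X\<in>orbits G E \<phi>. card X)"
    using disjoint_sum[OF assms(1), of "\<lambda>_. 1 :: nat"] by simp
  then obtain X where X: "X \<in> orbits G E \<phi>" "\<not> p dvd card X"
    using assms(4) by (metis dvd_sum)
  then obtain x where x: "x \<in> E" "X = orbit G \<phi> x" by (auto simp: orbits_def)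
  have "card X * card (stabilizer G \<phi> x) = p ^ n"
    using orbit_stabilizer_theorem[OF x(1)] assms(3) x(2) by (simp add: mult.commute)
  hence "card X dvd p ^ n" by (metis dvd_triv_left)
  hence "card X = 1"
    using X(2) assms(2) by (metis divides_primepow_nat dvd_power gr0I power_0)
  hence "X = {x}" using orbit_refl[OF x(1)] x(2) by (metis card_1_singletonE singletonD)
  thus ?thesis using x by (auto simp: orbit_def intro!: bexI[of _ x])
qed

text \<open>Let \<open>H\<close> act on the cosets of \<open>P\<close>. Their number is prime to
  \<open>p\<close>, so some coset \<open>P #> g\<close> is fixed, which says that \<open>g\<close>
  conjugates \<open>H\<close> into \<open>P\<close>.\<close>

lemma (in group) p_subgroup_conjugate_into:
  assumes "finite (carrier G)" "Factorial_Ring.prime p"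
    and H: "subgroup H G" "card H = p ^ n"
    and P: "subgroup P G" "\<not> p dvd card (rcosets P)"
  shows "\<exists>g\<in>carrier G. \<forall>h\<in>H. g \<otimes> h \<otimes> inv g \<in> P"
proof -
  interpret P: subgroup P G by fact
  interpret H: subgroup H G by fact
  interpret A: group_action "G\<lparr>carrier := H\<rparr>" "rcosets P" "\<lambda>h. \<lambda>R \<in> rcosets P. R #> inv h"
    using action_on_rcosets H(1) P(1) .
  have "rcosets P \<subseteq> Pow (carrier G)"
    using P.rcosets_carrier is_group by blast
  hence "finite (rcosets P)" using assms(1) by (meson finite_Pow_iff finite_subset)
  then obtain R where R: "R \<in> rcosets P" "\<forall>h\<in>H. R #> inv h = R"
    using A.fixed_point_of_prime_power[of p n] assms by (auto simp: order_def)
  then obtain g where g: "g \<in> carrier G" "R = P #> g" by (auto simp: RCOSETS_def)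
  show ?thesis
  proof (intro bexI[OF _ g(1)] ballI)
    fix h assume h: "h \<in> H"
    hence h': "h \<in> carrier G" by auto
    have "P #> g #> h = R"
      using R(2) H.m_inv_closed[OF h] h' g by (metis inv_inv)
    hence "P #> (g \<otimes> h) = P #> g"
      using g h' P.subset by (simp add: coset_mult_assoc)
    moreover have "g \<otimes> h \<in> P #> (g \<otimes> h)"
      using g h' P.one_closed rcos_self[OF _ P(1)] by auto
    ultimately obtain q where "q \<in> P" "g \<otimes> h = q \<otimes> g" by (auto simp: r_coset_def)
    thus "g \<otimes> h \<otimes> inv g \<in> P" using g by (simp add: m_assoc subsetD[OF P.subset])
  qed
qed

lemma (in group) sylow_subgroups_conjugate:
  assumes "finite (carrier G)" "Factorial_Ring.prime p"
    and "sylow_subgroup p P G" "sylow_subgroup p Q G"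
  shows "\<exists>g\<in>carrier G. (\<lambda>h. g \<otimes> h \<otimes> inv g) ` Q = P"
proof -
  let ?m = "multiplicity p (order G)"
  have P: "subgroup P G" "card P = p ^ ?m" and Q: "subgroup Q G" "card Q = p ^ ?m"
    using assms(3,4) by (auto simp: sylow_subgroup_def)
  have index: "card (rcosets P) * p ^ ?m = order G"
    using lagrange[OF P(1)] P(2) by simp
  \<comment> \<open>Otherwise one more factor \<open>p\<close> would divide the group order than its
    multiplicity permits.\<close>
  have "\<not> p dvd card (rcosets P)"
  proof
    assume "p dvd card (rcosets P)"
    hence "p ^ Suc ?m dvd order G"
      using index by (metis mult_dvd_mono dvd_refl power_Suc)
    moreover have "order G \<noteq> 0" "\<not> is_unit p"
      using assms(1,2) order_gt_0_iff_finite by (auto simp: not_prime_unit)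
    ultimately have "Suc ?m \<le> ?m"
      by (subst (asm) power_dvd_iff_le_multiplicity) auto
    thus False by simp
  qed
  then obtain g where g: "g \<in> carrier G" "\<forall>h\<in>Q. g \<otimes> h \<otimes> inv g \<in> P"
    using p_subgroup_conjugate_into[OF assms(1,2) Q P(1)] by blast
  have "inj_on (\<lambda>h. g \<otimes> h \<otimes> inv g) Q"
    using g(1) subgroup.mem_carrier[OF Q(1)] by (intro inj_onI) simp
  hence "card ((\<lambda>h. g \<otimes> h \<otimes> inv g) ` Q) = card P"
    using P Q by (simp add: card_image)
  moreover have "finite P" using subgroup.subset[OF P(1)] assms(1) by (rule finite_subset)
  ultimately have "(\<lambda>h. g \<otimes> h \<otimes> inv g) ` Q = P"
    using g(2) by (intro card_subset_eq) auto
  thus ?thesis using g(1) by blast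
qed

section \<open>Commutators\<close>

text \<open>This inverse-free form lets commutators of trees be checked by multiplication
  alone.\<close>

lemma (in group) eq_commutator_iff:
  assumes "t \<in> carrier G" "x \<in> carrier G" "y \<in> carrier G"
  shows "t = commutator G x y \<longleftrightarrow> t \<otimes> (y \<otimes> x) = x \<otimes> y"
proof -
  have "t = x \<otimes> y \<otimes> inv x \<otimes> inv y \<longleftrightarrow> x \<otimes> y \<otimes> inv x = t \<otimes> y"
    using assms by (intro inv_solve_right) auto
  also have "\<dots> \<longleftrightarrow> t \<otimes> y = x \<otimes> y \<otimes> inv x" by auto
  also have "\<dots> \<longleftrightarrow> x \<otimes> y = t \<otimes> y \<otimes> x"
    using assms by (intro inv_solve_right) auto
  finally show ?thesis
    unfolding commutator_def using assms by (auto simp: m_assoc)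
qed

text \<open>Here \<open>f\<close> is a homomorphism to the group of order 2, which is abelian, so
  \<open>f\<close> kills all commutators.\<close>

lemma (in group) not_in_derived_if_odd:
  assumes hom: "\<And>x y. x \<in> carrier G \<Longrightarrow> y \<in> carrier G \<Longrightarrow> f (x \<otimes> y) \<longleftrightarrow> f x \<noteq> f y"
    and "t \<in> derived G (carrier G)"
  shows "\<not> f t"
proof -
  have one: "\<not> f \<one>" using hom[of \<one> \<one>] by simp
  have inv: "f (inv x) \<longleftrightarrow> f x" if "x \<in> carrier G" for x
    using hom[of x "inv x"] one that by simp
  have comm: "\<not> f (x \<otimes> y \<otimes> inv x \<otimes> inv y)" if "x \<in> carrier G" "y \<in> carrier G" for x y
    using that by (auto simp: hom inv)
  show ?thesis
    using assms(2)[unfolded derived_def]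
  proof (induction rule: generate.induct)
    case (eng x y)
    thus ?case
      using hom generate_in_carrier[OF derived_set_in_carrier[OF subset_refl]] by auto
  qed (auto simp: one comm inv)
qed

lemma (in group) commutator_length_eq:
  assumes "x \<in> carrier G" "y \<in> carrier G"
  shows "commutator_length G (commutator G x y) = (if commutator G x y = \<one> then 0 else 1)"
proof -
  have "\<exists>xys. length xys = 1 \<and> set xys \<subseteq> carrier G \<times> carrier G \<and>
      commutator G x y = foldr (\<lambda>(x, y) h. commutator G x y \<otimes> h) xys \<one>"
    using assms by (intro exI[of _ "[(x, y)]"]) (simp add: commutator_def)
  thus ?thesis
    unfolding commutator_length_def
    by (auto intro!: Least_equality simp: Suc_le_eq)
qed

text \<open>The set of lengths is \<open>{0}\<close> or \<open>{0, 1}\<close>, hence finite and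
  nonempty, so \<open>Max\<close> has its intended meaning.\<close>

lemma (in group) commutator_width_eq:
  assumes "\<And>t. t \<in> derived G (carrier G) \<Longrightarrow> \<exists>x\<in>carrier G. \<exists>y\<in>carrier G. t = commutator G x y"
  shows "commutator_width G = (if derived G (carrier G) = {\<one>} then 0 else 1)"
proof -
  have len: "commutator_length G t = (if t = \<one> then 0 else 1)" if "t \<in> derived G (carrier G)" for t
  proof -
    from assms[OF that] obtain x y where "x \<in> carrier G" "y \<in> carrier G" "t = commutator G x y"
      by blast
    thus ?thesis using commutator_length_eq[of x y] by simp
  qed
  have one: "\<one> \<in> derived G (carrier G)"
    unfolding derived_def by (rule generate.one)
  show ?thesis
  proof (cases "derived G (carrier G) = {\<one>}")
    case False
    hence "commutator_length G ` derived G (carrier G) = {0, 1}"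
      using one by (force simp: len image_iff)
    thus ?thesis using False by (simp add: commutator_width_def)
  qed (simp add: commutator_width_def len)
qed

text \<open>Commutators are found among trees; this carries the result over to a Sylow subgroup of
  permutations.\<close>

lemma (in group_hom) commutator_width_iso:
  assumes bij: "bij_betw h (carrier G) (carrier H)"
    and comm: "\<And>t. t \<in> derived G (carrier G) \<Longrightarrow>
      \<exists>x\<in>carrier G. \<exists>y\<in>carrier G. t = commutator G x y"
  shows "commutator_width H = (if derived G (carrier G) = {\<one>\<^bsub>G\<^esub>} then 0 else 1)"
proof -
  let ?D = "derived G (carrier G)"
  have D: "derived H (carrier H) = h ` ?D"
    using derived_img[of "carrier G"] bij by (simp add: bij_betw_def)
  have sub: "?D \<subseteq> carrier G" by (rule G.derived_in_carrier) simp
  have width: "commutator_width H = (if derived H (carrier H) = {\<one>\<^bsub>H\<^esub>} then 0 else 1)"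
  proof (rule H.commutator_width_eq)
    fix t assume "t \<in> derived H (carrier H)"
    then obtain x y where "x \<in> carrier G" "y \<in> carrier G" "t = h (commutator G x y)"
      using D comm by blast
    thus "\<exists>x\<in>carrier H. \<exists>y\<in>carrier H. t = commutator H x y"
      by (intro bexI[of _ "h x"] bexI[of _ "h y"]) (auto simp: commutator_def)
  qed
  have "h ` ?D = {\<one>\<^bsub>H\<^esub>} \<longleftrightarrow> ?D = {\<one>\<^bsub>G\<^esub>}"
    using inj_on_image_eq_iff[of h "carrier G" ?D "{\<one>\<^bsub>G\<^esub>}"] bij sub
    by (simp add: bij_betw_def)
  thus ?thesis using width by (simp only: D)
qed

section \<open>The iterated wreath product\<close>

text \<open>\<open>Node e a b\<close> stands for the element \<open>(a, b) \<sigma>\<^sup>e\<close> of \<open>W \<wr> C\<^sub>2\<close>, where \<open>\<sigma>\<close> swaps the two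
  factors; so \<open>trees k\<close> is the \<open>k\<close>-fold iterated wreath product of groups of order 2.\<close>

datatype tree = Leaf | Node bool tree tree

fun trees :: "nat \<Rightarrow> tree set" where
  "trees 0 = {Leaf}"
| "trees (Suc k) = (\<lambda>(e, a, b). Node e a b) ` (UNIV \<times> trees k \<times> trees k)"

text \<open>Moving a swap past \<open>(c, d)\<close> exchanges the two entries. For trees of equal
  depth the last equation applies only to \<open>Leaf\<close> and \<open>Leaf\<close>, the product
  in the trivial group.\<close>

fun tmul :: "tree \<Rightarrow> tree \<Rightarrow> tree" where
  "tmul (Node e a b) (Node f c d) =
     Node (e \<noteq> f) (tmul a (if e then d else c)) (tmul b (if e then c else d))"
| "tmul _ _ = Leaf"

fun tone :: "nat \<Rightarrow> tree" where
  "tone 0 = Leaf"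
| "tone (Suc k) = Node False (tone k) (tone k)"

fun tinv :: "tree \<Rightarrow> tree" where
  "tinv Leaf = Leaf"
| "tinv (Node e a b) = Node e (if e then tinv b else tinv a) (if e then tinv a else tinv b)"

text \<open>The sum modulo 2 of the labels at depth \<open>i\<close>. Taken over all levels, these
  parities give the abelianization of the wreath product.\<close>

fun level_parity :: "tree \<Rightarrow> nat \<Rightarrow> bool" where
  "level_parity (Node e a b) 0 = e"
| "level_parity (Node e a b) (Suc i) = (level_parity a i \<noteq> level_parity b i)"
| "level_parity Leaf i = False"

text \<open>Only the labels directly above the leaves count: a swap of two subtrees with more than one leaf
  each is an even permutation of the leaves.\<close>

fun odd_tree :: "tree \<Rightarrow> bool" where
  "odd_tree Leaf = False"
| "odd_tree (Node e a b) = ((a = Leaf \<and> e) \<noteq> (odd_tree a \<noteq> odd_tree b))"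

definition tree_group :: "nat \<Rightarrow> tree monoid" where
  "tree_group k = \<lparr>carrier = trees k, mult = tmul, one = tone k\<rparr>"

definition even_trees :: "nat \<Rightarrow> tree set" where
  "even_trees k = {t \<in> trees k. \<not> odd_tree t}"

lemma Node_in_trees [simp]: "Node e a b \<in> trees (Suc k) \<longleftrightarrow> a \<in> trees k \<and> b \<in> trees k"
  by force

lemma trees_SucE:
  assumes "t \<in> trees (Suc k)"
  obtains e a b where "t = Node e a b" "a \<in> trees k" "b \<in> trees k"
  using assms by auto

lemma Leaf_in_trees [simp]: "Leaf \<in> trees k \<longleftrightarrow> k = 0"
  by (cases k) auto

declare trees.simps(2) [simp del]

lemma trees_eq_Leaf_iff: "t \<in> trees k \<Longrightarrow> t = Leaf \<longleftrightarrow> k = 0"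
  by (cases k) (auto elim: trees_SucE)

lemma tmul_closed [simp]: "s \<in> trees k \<Longrightarrow> t \<in> trees k \<Longrightarrow> tmul s t \<in> trees k"
  by (induction k arbitrary: s t) (auto elim!: trees_SucE)

lemma tone_closed [simp]: "tone k \<in> trees k"
  by (induction k) auto

lemma tinv_closed [simp]: "t \<in> trees k \<Longrightarrow> tinv t \<in> trees k"
  by (induction k arbitrary: t) (auto elim!: trees_SucE)

lemma tmul_assoc:
  "r \<in> trees k \<Longrightarrow> s \<in> trees k \<Longrightarrow> t \<in> trees k \<Longrightarrow> tmul (tmul r s) t = tmul r (tmul s t)"
  by (induction k arbitrary: r s t) (auto elim!: trees_SucE)

lemma tone_tmul [simp]: "t \<in> trees k \<Longrightarrow> tmul (tone k) t = t"
  by (induction k arbitrary: t) (auto elim!: trees_SucE)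

lemma tmul_tone [simp]: "t \<in> trees k \<Longrightarrow> tmul t (tone k) = t"
  by (induction k arbitrary: t) (auto elim!: trees_SucE)

lemma tinv_tmul: "t \<in> trees k \<Longrightarrow> tmul (tinv t) t = tone k"
  by (induction k arbitrary: t) (auto elim!: trees_SucE)

lemma group_tree_group: "group (tree_group k)"
  by (rule groupI) (auto simp: tree_group_def tmul_assoc intro: tinv_tmul tinv_closed)

section \<open>Parity homomorphisms on trees\<close>

lemma level_parity_tmul:
  "s \<in> trees k \<Longrightarrow> t \<in> trees k \<Longrightarrow>
    level_parity (tmul s t) i \<longleftrightarrow> level_parity s i \<noteq> level_parity t i"
proof (induction k arbitrary: s t i)
  case (Suc k)
  from Suc.prems obtain e a b f c d where st: "s = Node e a b" "t = Node f c d"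
    "a \<in> trees k" "b \<in> trees k" "c \<in> trees k" "d \<in> trees k"
    by (elim trees_SucE)
  \<comment> \<open>A swap only exchanges the two summands of each lower level, and exclusive or is
    symmetric.\<close>
  thus ?case by (cases i; cases e) (auto simp: Suc.IH)
qed simp

lemma odd_tree_tmul:
  "s \<in> trees k \<Longrightarrow> t \<in> trees k \<Longrightarrow> odd_tree (tmul s t) \<longleftrightarrow> odd_tree s \<noteq> odd_tree t"
proof (induction k arbitrary: s t)
  case (Suc k)
  from Suc.prems obtain e a b f c d where st: "s = Node e a b" "t = Node f c d"
    "a \<in> trees k" "b \<in> trees k" "c \<in> trees k" "d \<in> trees k"
    by (elim trees_SucE)
  \<comment> \<open>All these subtrees have the same depth, so the test against \<open>Leaf\<close>
    in \<open>odd_tree\<close> has the same outcome for each of them.\<close>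
  hence "x = Leaf \<longleftrightarrow> k = 0" if "x \<in> {a, c, tmul a c, tmul a d}" for x
    using that by (auto simp: trees_eq_Leaf_iff[of _ k])
  thus ?case using st by (cases e) (auto simp: Suc.IH)
qed simp

lemma odd_tree_tone [simp]: "\<not> odd_tree (tone k)"
  by (induction k) auto

lemma subgroup_even_trees: "subgroup (even_trees k) (tree_group k)"
proof -
  interpret group "tree_group k" by (rule group_tree_group)
  show ?thesis
  proof (rule subgroupI)
    fix t assume t: "t \<in> even_trees k"
    hence "inv\<^bsub>tree_group k\<^esub> t \<in> trees k" "tmul (inv\<^bsub>tree_group k\<^esub> t) t = tone k"
      using inv_closed[of t] l_inv[of t] by (auto simp: tree_group_def even_trees_def)
    thus "inv\<^bsub>tree_group k\<^esub> t \<in> even_trees k"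
      using t odd_tree_tmul[of "inv\<^bsub>tree_group k\<^esub> t" k t] by (auto simp: even_trees_def)
  next
    show "even_trees k \<noteq> {}"
      using odd_tree_tone[of k] tone_closed[of k] unfolding even_trees_def by blast
  qed (auto simp: even_trees_def tree_group_def odd_tree_tmul)
qed

abbreviation even_tree_group :: "nat \<Rightarrow> tree monoid" where
  "even_tree_group k \<equiv> tree_group k\<lparr>carrier := even_trees k\<rparr>"

lemma group_even_tree_group: "group (even_tree_group k)"
  using group.subgroup_imp_group group_tree_group subgroup_even_trees by blast

text \<open>Writing \<open>t = (g, h)\<close>, the commutator of \<open>(1, y) \<sigma>\<close> and \<open>(u, g u)\<close> is \<open>(g, [y, u] g\<inverse>)\<close>,
  so it is enough to write \<open>h g\<close> as a commutator one level below.\<close>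

lemma Node_commutator:
  assumes "g \<in> trees k" "h \<in> trees k" "y \<in> trees k" "u \<in> trees k"
    and "tmul (tmul h g) (tmul u y) = tmul y u"
  shows "tmul (Node False g h) (tmul (Node False u (tmul g u)) (Node True (tone k) y)) =
         tmul (Node True (tone k) y) (Node False u (tmul g u))"
  using assms by (simp add: tmul_assoc[of _ k])

text \<open>Only \<open>y\<close> has to be even: it fixes the parity of the next
  \<open>Node True (tone k) y\<close>. The parity of \<open>u\<close> cancels in
  \<open>Node False u (tmul g u)\<close>, which has the parity of \<open>g\<close>, possibly odd
  here.\<close>

lemma commutator_even_factor:
  assumes "t \<in> trees k" "\<And>i. \<not> level_parity t i"
  shows "\<exists>y\<in>even_trees k. \<exists>u\<in>trees k. tmul t (tmul u y) = tmul y u"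
  using assms
proof (induction k arbitrary: t)
  case 0
  thus ?case by (simp add: even_trees_def)
next
  case (Suc k)
  from Suc.prems(1) obtain e g h where t: "t = Node e g h" "g \<in> trees k" "h \<in> trees k"
    by (rule trees_SucE)
  have [simp]: "e = False" using Suc.prems(2)[of 0] t by simp
  show ?case
  proof (cases "k = 0")
    \<comment> \<open>At depth 1 the general witness \<open>Node True Leaf Leaf\<close> is odd. But
      \<open>t\<close> is then the identity, so the identity serves as the even factor.\<close>
    case True
    thus ?thesis using t
      by (intro bexI[of _ "tone (Suc k)"]) (auto simp: even_trees_def)
  next
    case False
    have "\<not> level_parity (tmul h g) i" for i
      using Suc.prems(2)[of "Suc i"] t by (simp add: level_parity_tmul[of _ k])
    then obtain y u where "y \<in> even_trees k" "u \<in> trees k"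
      "tmul (tmul h g) (tmul u y) = tmul y u"
      using Suc.IH[of "tmul h g"] t by auto
    thus ?thesis using t Node_commutator[of g k h y u] False
      by (intro bexI[of _ "Node True (tone k) y"] bexI[of _ "Node False u (tmul g u)"])
         (auto simp: even_trees_def trees_eq_Leaf_iff[of _ k])
  qed
qed

text \<open>Besides the level parities, the even subgroup has one further homomorphism to the group
  of order 2: the parity of the left half. It must vanish on the derived subgroup too.\<close>

lemma derived_even_trees:
  assumes "t \<in> derived (even_tree_group (Suc k)) (even_trees (Suc k))" "k > 0"
  obtains g h where "t = Node False g h" "g \<in> even_trees k" "h \<in> even_trees k"
    "\<And>i. \<not> level_parity (tmul h g) i"
proof -
  interpret group "even_tree_group (Suc k)" by (rule group_even_tree_group)
  \<comment> \<open>For \<open>k > 0\<close> the root label does not affect \<open>odd_tree\<close>,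
    so both halves of an even tree have equal parity. Swapping them leaves \<open>left_odd\<close>
    unchanged, which makes it multiplicative on even trees.\<close>
  define left_odd where "left_odd t = (case t of Leaf \<Rightarrow> False | Node e a b \<Rightarrow> odd_tree a)" for t
  have "t \<in> even_trees (Suc k)"
    using derived_in_carrier[of "even_trees (Suc k)"] assms(1) by auto
  then obtain e g h where t: "t = Node e g h" "g \<in> trees k" "h \<in> trees k" "\<not> odd_tree t"
    by (auto simp: even_trees_def elim: trees_SucE)
  have "\<not> left_odd t"
  proof (rule not_in_derived_if_odd)
    fix x y assume "x \<in> carrier (even_tree_group (Suc k))" "y \<in> carrier (even_tree_group (Suc k))"
    hence "x \<in> trees (Suc k)" "\<not> odd_tree x" "y \<in> trees (Suc k)" "\<not> odd_tree y"
      by (auto simp: even_trees_def)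
    thus "left_odd (x \<otimes>\<^bsub>even_tree_group (Suc k)\<^esub> y) \<longleftrightarrow> left_odd x \<noteq> left_odd y"
      using assms(2)
      by (auto simp: tree_group_def left_odd_def odd_tree_tmul[of _ k] trees_eq_Leaf_iff[of _ k]
          elim!: trees_SucE split: if_splits)
  qed (use assms(1) in simp)
  hence odd: "\<not> odd_tree g" "\<not> odd_tree h"
    using t assms(2) by (auto simp: left_odd_def trees_eq_Leaf_iff[of _ k])
  have parity: "\<not> level_parity t i" for i
    using assms(1)
    by (intro not_in_derived_if_odd[where f = "\<lambda>t. level_parity t i"])
      (auto simp: tree_group_def even_trees_def level_parity_tmul[of _ "Suc k"])
  show thesis
  proof (rule that)
    show "t = Node False g h" using parity[of 0] t(1) by simp
    show "\<not> level_parity (tmul h g) i" for i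
      using parity[of "Suc i"] t by (simp add: level_parity_tmul[of _ k])
  qed (use t odd in \<open>auto simp: even_trees_def\<close>)
qed

lemma derived_even_tree_group_commutator:
  assumes "t \<in> derived (even_tree_group (Suc k)) (even_trees (Suc k))" "k > 0"
  shows "\<exists>x\<in>even_trees (Suc k). \<exists>y\<in>even_trees (Suc k). t = commutator (even_tree_group (Suc k)) x y"
proof -
  interpret group "even_tree_group (Suc k)" by (rule group_even_tree_group)
  from derived_even_trees[OF assms] obtain g h where t: "t = Node False g h"
    "g \<in> even_trees k" "h \<in> even_trees k" "\<And>i. \<not> level_parity (tmul h g) i" by blast
  hence gh: "g \<in> trees k" "h \<in> trees k" "\<not> odd_tree g" "\<not> odd_tree h"
    by (auto simp: even_trees_def)
  from commutator_even_factor[of "tmul h g" k] gh t(4) obtain y u where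
    yu: "y \<in> even_trees k" "u \<in> trees k" "tmul (tmul h g) (tmul u y) = tmul y u" by auto
  define X where "X = Node True (tone k) y"
  define Y where "Y = Node False u (tmul g u)"
  \<comment> \<open>\<open>X\<close> has the parity of \<open>y\<close> and \<open>Y\<close> that of
    \<open>g\<close>; both are even.\<close>
  have XY: "X \<in> even_trees (Suc k)" "Y \<in> even_trees (Suc k)"
    using yu gh assms(2)
    by (auto simp: X_def Y_def even_trees_def odd_tree_tmul[of _ k] trees_eq_Leaf_iff[of _ k])
  moreover have "tmul t (tmul Y X) = tmul X Y"
    unfolding t(1) X_def Y_def using yu gh
    by (intro Node_commutator) (auto simp: even_trees_def)
  moreover have "t \<in> even_trees (Suc k)"
    using t gh by (auto simp: even_trees_def)
  ultimately show ?thesis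
    using eq_commutator_iff[of t X Y] by (auto simp: tree_group_def)
qed

lemma derived_even_tree_group_trivial_iff:
  assumes "k > 0"
  shows "derived (even_tree_group (Suc k)) (even_trees (Suc k)) = {tone (Suc k)} \<longleftrightarrow> k = 1"
proof -
  interpret group "even_tree_group (Suc k)" by (rule group_even_tree_group)
  let ?D = "derived (even_tree_group (Suc k)) (even_trees (Suc k))"
  have one: "tone (Suc k) \<in> ?D"
    using generate.one[of "even_tree_group (Suc k)"] by (simp add: derived_def tree_group_def)
  show ?thesis
  proof
    assume "k = 1"
    \<comment> \<open>The only even tree of depth 1 is the identity, so both halves of an element of
      the derived subgroup are trivial.\<close>
    have E1: "g = tone 1" if "g \<in> even_trees 1" for g
      using that by (auto simp: even_trees_def elim!: trees_SucE)
    have "t = tone (Suc k)" if "t \<in> ?D" for t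
      using derived_even_trees[OF that assms] E1 \<open>k = 1\<close> by (metis tone.simps(2))
    thus "?D = {tone (Suc k)}"
      using one by blast
  next
    assume D: "?D = {tone (Suc k)}"
    show "k = 1"
    proof (rule ccontr)
      assume "k \<noteq> 1"
      then obtain l where k: "k = Suc l" "l > 0" using assms by (cases k) auto
      text \<open>The commutator of \<open>\<sigma>\<close> and \<open>(1, g)\<close> is \<open>(g, g\<inverse>)\<close>; here \<open>g\<close> is an involution.\<close>
      define g where "g = Node True (tone l) (tone l)"
      define t where "t = Node False g g"
      define X where "X = Node True (tone k) (tone k)"
      define Y where "Y = Node False (tone k) g"
      \<comment> \<open>\<open>g\<close> swaps two subtrees with more than one leaf each, as
        \<open>l > 0\<close>, and is therefore even.\<close>
      have *: "g \<in> trees k" "tmul g g = tone k" "\<not> odd_tree g" "tone k \<noteq> Leaf"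
        using k(2) trees_eq_Leaf_iff[OF tone_closed[of l]] by (auto simp: k(1) g_def)
      have "tmul t (tmul Y X) = tmul X Y"
        using * by (simp add: t_def X_def Y_def)
      moreover have XY: "X \<in> even_trees (Suc k)" "Y \<in> even_trees (Suc k)" "t \<in> even_trees (Suc k)"
        using * by (auto simp: X_def Y_def t_def even_trees_def)
      ultimately have "t = commutator (even_tree_group (Suc k)) X Y"
        using eq_commutator_iff[of t X Y] by (auto simp: tree_group_def)
      hence "t \<in> ?D"
        unfolding derived_def commutator_def using XY by (intro generate.incl) auto
      thus False using D by (simp add: t_def g_def k)
    qed
  qed
qed

section \<open>The order of the group of even trees\<close>

lemma finite_trees [simp]: "finite (trees k)"
  by (induction k) (auto simp: trees.simps)

text \<open>There is one free label at each of the \<open>2 ^ k - 1\<close> inner nodes.\<close>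

lemma card_trees: "card (trees k) = 2 ^ (2 ^ k - 1)"
proof (induction k)
  case (Suc k)
  have "card (trees (Suc k)) = 2 * (card (trees k) * card (trees k))"
    unfolding trees.simps(2) by (subst card_image) (auto simp: inj_on_def card_cartesian_product)
  also have "\<dots> = 2 ^ (1 + (2 ^ k - 1) + (2 ^ k - 1))"
    by (simp only: Suc power_add power_one_right mult.assoc)
  also have "1 + (2 ^ k - 1) + (2 ^ k - 1) = 2 ^ Suc k - (1 :: nat)"
    using one_le_power[of "2 :: nat" k] by simp
  finally show ?case .
qed simp

text \<open>Toggles the leftmost label directly above the leaves. This involution matches the even
  trees with the odd ones.\<close>

fun flip :: "tree \<Rightarrow> tree" where
  "flip Leaf = Leaf"
| "flip (Node e a b) = (if a = Leaf then Node (\<not> e) a b else Node e (flip a) b)"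

lemma flip_eq_Leaf_iff [simp]: "flip t = Leaf \<longleftrightarrow> t = Leaf"
  by (cases t) auto

lemma flip_flip [simp]: "flip (flip t) = t"
  by (induction t) auto

lemma flip_in_trees [simp]: "t \<in> trees k \<Longrightarrow> flip t \<in> trees k"
  by (induction k arbitrary: t) (auto elim!: trees_SucE)

lemma odd_tree_flip: "t \<noteq> Leaf \<Longrightarrow> odd_tree (flip t) \<longleftrightarrow> \<not> odd_tree t"
  by (induction t) auto

lemma card_even_trees:
  assumes "k > 0"
  shows "card (even_trees k) = 2 ^ (2 ^ k - 2)"
proof -
  let ?O = "{t \<in> trees k. odd_tree t}"
  have nonleaf: "t \<noteq> Leaf" if "t \<in> trees k" for t
    using trees_eq_Leaf_iff[OF that] assms by simp
  have "bij_betw flip (even_trees k) ?O"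
    by (rule bij_betwI[where g = flip]) (auto simp: even_trees_def odd_tree_flip nonleaf)
  hence "card ?O = card (even_trees k)" by (simp add: bij_betw_same_card)
  moreover have "card (trees k) = card (even_trees k) + card ?O"
    by (subst card_Un_disjoint [symmetric]) (auto simp: even_trees_def intro!: arg_cong[of _ _ card])
  ultimately have "2 * card (even_trees k) = 2 ^ (2 ^ k - 1)"
    by (simp add: card_trees)
  also have "2 ^ k - 1 = Suc (2 ^ k - 2 :: nat)"
    using power_increasing[of 1 k "2 :: nat"] assms by simp
  finally show ?thesis by simp
qed

section \<open>The action on the leaves\<close>

text \<open>The point 0 falls under the first case; it stays fixed whenever \<open>g\<close>
  permutes \<open>{1..n}\<close>.\<close>

definition block :: "nat \<Rightarrow> (nat \<Rightarrow> nat) \<Rightarrow> (nat \<Rightarrow> nat) \<Rightarrow> nat \<Rightarrow> nat" where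
  "block n g h = (\<lambda>i. if i \<le> n then g i else n + h (i - n))"

definition block_swap :: "nat \<Rightarrow> nat \<Rightarrow> nat" where
  "block_swap n = (\<lambda>i. if i = 0 \<or> 2 * n < i then i else if i \<le> n then i + n else i - n)"

lemma permutes_atLeastAtMostD:
  assumes "g permutes {1..n::nat}"
  shows "g i \<le> n \<longleftrightarrow> i \<le> n" "g i = 0 \<longleftrightarrow> i = 0" "g 0 = 0" "n < i \<Longrightarrow> g i = i"
proof -
  show 0: "g 0 = 0" and "n < i \<Longrightarrow> g i = i"
    using permutes_not_in[OF assms] by auto
  show "g i = 0 \<longleftrightarrow> i = 0" 
    using inj_eq[OF permutes_inj[OF assms], of i 0] 0 by simp
  thus "g i \<le> n \<longleftrightarrow> i \<le> n"
    using permutes_in_image[OF assms, of i] permutes_not_in[OF assms, of i] 0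
    by (cases "i = 0") auto
qed

lemma block_comp:
  assumes "g permutes {1..n}" "h permutes {1..n}" "g' permutes {1..n}" "h' permutes {1..n}"
  shows "block n g h \<circ> block n g' h' = block n (g \<circ> g') (h \<circ> h')"
  using assms[THEN permutes_atLeastAtMostD(1)] assms[THEN permutes_atLeastAtMostD(2)]
  by (auto simp: block_def fun_eq_iff simp flip: neq0_conv)

lemma block_id [simp]: "block n id id = id"
  by (auto simp: block_def fun_eq_iff)

lemma block_left [simp]: "g permutes {1..n} \<Longrightarrow> block n g id = g"
  using permutes_atLeastAtMostD(4) by (fastforce simp: block_def)

lemma block_inject:
  assumes "g permutes {1..n}" "h permutes {1..n}" "g' permutes {1..n}" "h' permutes {1..n}"
  shows "block n g h = block n g' h' \<longleftrightarrow> g = g' \<and> h = h'"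
proof
  assume eq: "block n g h = block n g' h'"
  have "g i = g' i" for i
    using fun_cong[OF eq, of i] assms[THEN permutes_atLeastAtMostD(4), of i]
    by (cases "i \<le> n") (auto simp: block_def)
  moreover have "h i = h' i" for i
    using fun_cong[OF eq, of "n + i"] assms[THEN permutes_atLeastAtMostD(3)]
    by (cases "i = 0") (auto simp: block_def)
  ultimately show "g = g' \<and> h = h'" by auto
qed auto

text \<open>The block of the inverses is the inverse, so the map is a bijection of all naturals;
  fixing everything outside the interval, it permutes the interval.\<close>

lemma block_permutes:
  assumes "g permutes {1..n}" "h permutes {1..n}"
  shows "block n g h permutes {1..2 * n}"
proof (rule bij_imp_permutes)
  have "bij (block n g h)"
    using assms by (intro o_bij[where g = "block n (inv' g) (inv' h)"])
      (simp_all add: block_comp permutes_inv permutes_inv_o)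
  moreover show fixed: "block n g h i = i" if "i \<notin> {1..2 * n}" for i
    using that assms[THEN permutes_atLeastAtMostD(3)]
      permutes_atLeastAtMostD(4)[OF assms(2), of "i - n"]
    by (cases "i = 0") (auto simp: block_def)
  ultimately show "bij_betw (block n g h) {1..2 * n} {1..2 * n}"
    using permutes_imp_bij[of "block n g h"] by (auto simp: permutes_def bij_iff)
qed

lemma block_swap_swap [simp]: "block_swap n \<circ> block_swap n = id"
  by (auto simp: block_swap_def fun_eq_iff)

lemma block_swap_permutes: "block_swap n permutes {1..2 * n}"
proof (rule bij_imp_permutes)
  show "bij_betw (block_swap n) {1..2 * n} {1..2 * n}"
    by (rule bij_betwI[where g = "block_swap n"]) (auto simp: block_swap_def)
qed (auto simp: block_swap_def)

lemma block_swap_block: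
  assumes "g permutes {1..n}" "h permutes {1..n}"
  shows "block_swap n \<circ> block n g h = block n h g \<circ> block_swap n"
proof
  fix i
  consider "i = 0" | "1 \<le> i" "i \<le> n" | "n < i" "i \<le> 2 * n" | "2 * n < i" by linarith
  thus "(block_swap n \<circ> block n g h) i = (block n h g \<circ> block_swap n) i"
  proof cases
    case 2
    hence "g i \<le> n" "g i \<noteq> 0" using permutes_atLeastAtMostD(1,2)[OF assms(1), of i] by auto
    thus ?thesis using 2 by (simp add: block_def block_swap_def)
  next
    case 3
    hence "i - n \<le> n" "h (i - n) \<le> n" "h (i - n) \<noteq> 0"
      using permutes_atLeastAtMostD(1,2)[OF assms(2), of "i - n"] by auto
    thus ?thesis using 3 by (simp add: block_def block_swap_def)
  next
    case 4
    thus ?thesis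
      using permutes_atLeastAtMostD(4)[OF assms(1), of "i - n"]
        permutes_atLeastAtMostD(4)[OF assms(2), of "i - n"]
      by (simp add: block_def block_swap_def)
  qed (use assms[THEN permutes_atLeastAtMostD(3)] in \<open>simp add: block_def block_swap_def\<close>)
qed

lemma permutation_atLeastAtMost: "g permutes {a..b::nat} \<Longrightarrow> permutation g"
  using permutation_permutes by blast

text \<open>Factor \<open>(g, h)\<close> as \<open>(g, 1) (1, h)\<close>. The second factor is a
  conjugate of \<open>h\<close> by the block swap, so the signs of \<open>g\<close> and
  \<open>h\<close> multiply.\<close>

lemma evenperm_block:
  assumes "g permutes {1..n}" "h permutes {1..n}"
  shows "evenperm (block n g h) \<longleftrightarrow> (evenperm g \<longleftrightarrow> evenperm h)"
proof -
  note perm = permutation_atLeastAtMost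
  have id: "id permutes {1..n}" by (rule permutes_id)
  have "block n g h = g \<circ> block n id h"
    using block_comp[OF assms(1) id id assms(2)] assms(1) by simp
  also have "block n id h = block_swap n \<circ> h \<circ> block_swap n"
    using block_swap_block[OF assms(2) id] assms(2)
    by (simp add: comp_assoc)
  finally show ?thesis
    using perm[OF assms(1)] perm[OF assms(2)] perm[OF block_swap_permutes[of n]]
    by (metis evenperm_comp permutation_compose)
qed

lemma evenperm_block_swap:
  assumes "even n"
  shows "evenperm (block_swap n)"
proof -
  from assms obtain m where n: "n = 2 * m" by blast
  \<comment> \<open>Rotation of \<open>{1..4 * m}\<close> by \<open>m\<close>. Its fourth power is
    the identity, so its cube is its inverse.\<close>
  define r where "r i = (if i = 0 \<or> 4 * m < i then i else if i \<le> 3 * m then i + m else i - 3 * m)"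
    for i
  have "r permutes {1..4 * m}"
  proof (rule bij_imp_permutes)
    show "bij_betw r {1..4 * m} {1..4 * m}"
      by (rule bij_betwI[where g = "r \<circ> r \<circ> r"]) (auto simp: r_def)
  qed (auto simp: r_def)
  \<comment> \<open>the swap is the square of a rotation\<close>
  moreover have "block_swap n = r \<circ> r"
    by (auto simp: block_swap_def r_def n fun_eq_iff)
  ultimately show ?thesis
    using permutation_atLeastAtMost by (metis evenperm_comp)
qed

lemma not_evenperm_block_swap_1: "\<not> evenperm (block_swap 1)"
proof -
  have "block_swap 1 = transpose 1 2"
    by (auto simp: block_swap_def transpose_def fun_eq_iff)
  thus ?thesis by (simp add: evenperm_swap)
qed

text \<open>The action on the leaves, numbered from 1. The swap is applied first, in accordance with
  \<open>(a, b) \<sigma>\<close> and the order of factors in \<open>tmul\<close>.\<close>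

fun act :: "nat \<Rightarrow> tree \<Rightarrow> nat \<Rightarrow> nat" where
  act_Node: "act (Suc k) (Node e a b) =
     block (2 ^ k) (act k a) (act k b) \<circ> (if e then block_swap (2 ^ k) else id)"
| "act _ _ = id"

declare act.simps [simp del]

lemma act_0 [simp]: "act 0 t = id"
  by (simp add: act.simps fun_eq_iff)

lemma act_permutes: "t \<in> trees k \<Longrightarrow> act k t permutes {1..2 ^ k}"
proof (induction k arbitrary: t)
  case 0
  show ?case by (simp only: act_0 permutes_id)
next
  case (Suc k)
  from Suc.prems obtain e a b where t: "t = Node e a b" "a \<in> trees k" "b \<in> trees k"
    by (rule trees_SucE)
  show ?case
    unfolding t(1) act_Node power_Suc
    using block_permutes[OF Suc.IH[OF t(2)] Suc.IH[OF t(3)]] block_swap_permutes permutes_id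
    by (intro permutes_compose) (simp_all split: if_split)
qed

lemma act_tmul:
  "s \<in> trees k \<Longrightarrow> t \<in> trees k \<Longrightarrow> act k (tmul s t) = act k s \<circ> act k t"
proof (induction k arbitrary: s t)
  case (Suc k)
  let ?S = "block_swap (2 ^ k)" and ?B = "\<lambda>x y. block (2 ^ k) (act k x) (act k y)"
  from Suc.prems obtain e a b f c d where st: "s = Node e a b" "t = Node f c d"
    "a \<in> trees k" "b \<in> trees k" "c \<in> trees k" "d \<in> trees k"
    by (elim trees_SucE)
  have B: "?B (tmul a x) (tmul b y) = ?B a b \<circ> ?B x y" if "x \<in> trees k" "y \<in> trees k" for x y
    unfolding Suc.IH[OF st(3) that(1)] Suc.IH[OF st(4) that(2)]
    using st that by (intro block_comp [symmetric] act_permutes)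
  have S: "?S \<circ> ?B c d = ?B d c \<circ> ?S"
    using st by (intro block_swap_block act_permutes)
  \<comment> \<open>The rule \<open>S\<close> inside a right-associated composition, to push every
    swap to the right.\<close>
  have S': "?S \<circ> (?B c d \<circ> z) = ?B d c \<circ> (?S \<circ> z)" for z :: "nat \<Rightarrow> nat"
    using S by (simp add: comp_assoc [symmetric])
  show ?case
    using st by (cases e; cases f)
        (simp_all only: act_Node tmul.simps B S S' comp_assoc block_swap_swap comp_id id_comp
          if_True if_False simp_thms)
qed simp

lemma act_inject:
  "s \<in> trees k \<Longrightarrow> t \<in> trees k \<Longrightarrow> act k s = act k t \<Longrightarrow> s = t"
proof (induction k arbitrary: s t)
  case (Suc k)
  let ?n = "2 ^ k :: nat"
  from Suc.prems(1,2) obtain e a b f c d where st: "s = Node e a b" "t = Node f c d"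
    "a \<in> trees k" "b \<in> trees k" "c \<in> trees k" "d \<in> trees k"
    by (elim trees_SucE)
  note perms = st(3-6)[THEN act_permutes]
  \<comment> \<open>Blocks preserve the two halves, so the half containing the image of 1 reveals
    the root label.\<close>
  have "act (Suc k) (Node e' a' b') 1 \<le> ?n \<longleftrightarrow> \<not> e'"
    if "a' \<in> trees k" "b' \<in> trees k" for e' a' b'
    using permutes_atLeastAtMostD(1)[OF act_permutes[OF that(1)], of 1]
      permutes_atLeastAtMostD(2)[OF act_permutes[OF that(2)], of 1]
    by (auto simp: act_Node block_def block_swap_def)
  hence "e = f" using st Suc.prems(3) by metis
  define X where "X = (if e then block_swap ?n else id)"
  have X: "X \<circ> X = id" by (simp add: X_def)
  have "block ?n (act k a) (act k b) \<circ> X = block ?n (act k c) (act k d) \<circ> X"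
    using Suc.prems(3) unfolding st(1,2) act_Node X_def \<open>e = f\<close> .
  hence "block ?n (act k a) (act k b) \<circ> (X \<circ> X) = block ?n (act k c) (act k d) \<circ> (X \<circ> X)"
    by (simp only: comp_assoc [symmetric])
  hence "block ?n (act k a) (act k b) = block ?n (act k c) (act k d)"
    by (simp only: X comp_id)
  thus ?case
    using Suc.IH st \<open>e = f\<close> unfolding block_inject[OF perms] by blast
qed simp

text \<open>A swap of blocks of even length is an even permutation; only the labels directly above
  the leaves act as odd ones.\<close>

lemma evenperm_act: "t \<in> trees k \<Longrightarrow> evenperm (act k t) \<longleftrightarrow> \<not> odd_tree t"
proof (induction k arbitrary: t)
  case (Suc k)
  from Suc.prems obtain e a b where t: "t = Node e a b" "a \<in> trees k" "b \<in> trees k"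
    by (rule trees_SucE)
  note perms = t(2,3)[THEN act_permutes]
  have "evenperm (block_swap (2 ^ k)) \<longleftrightarrow> k \<noteq> 0"
    using evenperm_block_swap[of "2 ^ k"] not_evenperm_block_swap_1 by (cases "k = 0") auto
  hence "evenperm (act (Suc k) t) \<longleftrightarrow>
      ((evenperm (act k a) \<longleftrightarrow> evenperm (act k b)) \<longleftrightarrow> \<not> (e \<and> k = 0))"
    using t(1) evenperm_block[OF perms]
      permutation_atLeastAtMost[OF block_permutes[OF perms]]
      permutation_atLeastAtMost[OF block_swap_permutes[of "2 ^ k"]]
    by (auto simp: act_Node evenperm_comp)
  thus ?case using t Suc.IH by (auto simp: trees_eq_Leaf_iff)
qed simp

lemma act_hom: "act k \<in> hom (even_tree_group k) (alt_group (2 ^ k))"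
proof (rule homI)
  fix s t assume "s \<in> carrier (even_tree_group k)" "t \<in> carrier (even_tree_group k)"
  hence st: "s \<in> trees k" "t \<in> trees k" "\<not> odd_tree s" by (simp_all add: even_trees_def)
  thus "act k s \<in> carrier (alt_group (2 ^ k))"
    unfolding alt_group_carrier using act_permutes evenperm_act by blast
  show "act k (s \<otimes>\<^bsub>even_tree_group k\<^esub> t) = act k s \<otimes>\<^bsub>alt_group (2 ^ k)\<^esub> act k t"
    unfolding alt_group_mult act_tmul[OF st(1,2), symmetric] by (simp add: tree_group_def)
qed

lemma act_inj_on: "inj_on (act k) (even_trees k)"
  unfolding inj_on_def even_trees_def using act_inject by blast

section \<open>The 2-part of the order of the alternating group\<close>

lemma multiplicity_2_fact_double: "multiplicity 2 (fact (2 * n) :: nat) = n + multiplicity 2 (fact n :: nat)"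
proof (induction n)
  case (Suc n)
  have mult: "multiplicity 2 (a * b) = multiplicity 2 a + multiplicity 2 b" if "a > 0" "b > 0"
    for a b :: nat
    using that by (intro prime_elem_multiplicity_mult_distrib) auto
  \<comment> \<open>The new factors are \<open>2 * n + 1\<close>, which is odd, and
    \<open>2 * Suc n\<close>, whose multiplicity exceeds that of \<open>Suc n\<close> by
    one.\<close>
  have fact: "fact (2 * Suc n) = (2 * Suc n) * ((2 * n + 1) * fact (2 * n :: nat) :: nat)"
    by (simp add: algebra_simps)
  have "multiplicity 2 (fact (2 * Suc n) :: nat) =
      multiplicity 2 (2 * Suc n) + multiplicity 2 ((2 * n + 1) * fact (2 * n :: nat) :: nat)"
    unfolding fact by (rule mult) auto
  also have "multiplicity 2 ((2 * n + 1) * fact (2 * n :: nat) :: nat) =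
      multiplicity 2 (2 * n + 1) + multiplicity 2 (fact (2 * n) :: nat)"
    by (rule mult) auto
  also have "multiplicity 2 (2 * Suc n) = Suc (multiplicity 2 (Suc n))"
    by (rule multiplicity_times_same) auto
  also have "multiplicity 2 (2 * n + 1) = 0"
    by (rule not_dvd_imp_multiplicity_0) simp
  finally have *: "multiplicity 2 (fact (2 * Suc n) :: nat) =
      Suc (multiplicity 2 (Suc n)) + (0 + (n + multiplicity 2 (fact n :: nat)))"
    using Suc by simp
  have "multiplicity 2 (fact (Suc n) :: nat) = multiplicity 2 (Suc n) + multiplicity 2 (fact n :: nat)"
    using mult[of "Suc n" "fact n"] by simp
  thus ?case using * by linarith
qed simp

lemma multiplicity_2_fact_power: "multiplicity 2 (fact (2 ^ k) :: nat) = 2 ^ k - 1"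
proof (induction k)
  case (Suc k)
  thus ?case
    using multiplicity_2_fact_double[of "2 ^ k"] one_le_power[of "2 :: nat" k] by simp
qed simp

lemma multiplicity_2_order_alt_group:
  assumes "k > 0"
  shows "multiplicity 2 (order (alt_group (2 ^ k))) = 2 ^ k - 2"
proof -
  have order: "2 * order (alt_group (2 ^ k)) = fact (2 ^ k)"
    using alt_group_card_carrier[of "2 ^ k"] power_increasing[of 1 k "2 :: nat"] assms
    by (simp add: order_def)
  hence "order (alt_group (2 ^ k)) \<noteq> 0"
    by (intro notI) simp
  hence "multiplicity 2 (2 * order (alt_group (2 ^ k))) = Suc (multiplicity 2 (order (alt_group (2 ^ k))))"
    by (intro multiplicity_times_same) auto
  thus ?thesis using multiplicity_2_fact_power[of k] unfolding order by linarith
qed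

lemma finite_alt_group: "finite (carrier (alt_group n))"
  by (rule finite_subset[OF _ finite_permutations[of "{1..n}"]]) (auto simp: alt_group_carrier)

lemma sylow_subgroup_act:
  assumes "k > 0"
  shows "sylow_subgroup 2 (act k ` even_trees k) (alt_group (2 ^ k))"
proof -
  interpret group_hom "even_tree_group k" "alt_group (2 ^ k)" "act k"
    by (intro group_hom.intro group_hom_axioms.intro group_even_tree_group alt_group_is_group act_hom)
  show ?thesis
    using img_is_subgroup card_even_trees[OF assms] multiplicity_2_order_alt_group[OF assms]
    by (simp add: sylow_subgroup_def card_image act_inj_on)
qed

text \<open>At \<open>k = 2\<close> the Sylow subgroup is the Klein four-group, whose derived
  subgroup is trivial, so the width is 0 there and 1 only from \<open>k = 3\<close> on.\<close>

theorem corollary20: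
  fixes k :: nat and P :: "(nat \<Rightarrow> nat) set"
  assumes "k \<ge> 2"
    and "sylow_subgroup 2 P (alt_group (2 ^ k))"
  shows "commutator_width ((alt_group (2 ^ k))\<lparr>carrier := P\<rparr>) = (if k = 2 then 0 else 1)"
proof -
  define A where "A = alt_group (2 ^ k)"
  obtain l where k: "k = Suc l" "l > 0" using assms(1) by (cases k) auto
  interpret A: group A unfolding A_def by (rule alt_group_is_group)
  obtain g where g: "g \<in> carrier A" "(\<lambda>h. g \<otimes>\<^bsub>A\<^esub> h \<otimes>\<^bsub>A\<^esub> inv\<^bsub>A\<^esub> g) ` act k ` even_trees k = P"
    using A.sylow_subgroups_conjugate[of 2 P "act k ` even_trees k"] finite_alt_group
      assms(2) sylow_subgroup_act[of k] k by (auto simp: A_def)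
  \<comment> \<open>Acting on the leaves and then conjugating by \<open>g\<close> is an isomorphism
    from the even trees onto the given \<open>P\<close>.\<close>
  define f where "f t = g \<otimes>\<^bsub>A\<^esub> act k t \<otimes>\<^bsub>A\<^esub> inv\<^bsub>A\<^esub> g" for t
  have P: "subgroup P A" using assms(2) by (simp add: sylow_subgroup_def A_def)
  have act: "act k t \<in> carrier A" if "t \<in> even_trees k" for t
    using hom_in_carrier[OF act_hom, of t k] that by (simp add: A_def)
  have "f ` even_trees k = P" using g(2) by (simp add: f_def image_image)
  moreover have "inj_on f (even_trees k)"
    using g(1) act inj_onD[OF act_inj_on] by (intro inj_onI) (simp add: f_def)
  ultimately have bij: "bij_betw f (even_trees k) P" by (simp add: bij_betw_def)
  interpret group_hom "even_tree_group k" "A\<lparr>carrier := P\<rparr>" f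
  proof (intro group_hom.intro group_hom_axioms.intro homI)
    fix s t assume "s \<in> carrier (even_tree_group k)" "t \<in> carrier (even_tree_group k)"
    hence st: "s \<in> even_trees k" "t \<in> even_trees k" by auto
    have "act k (s \<otimes>\<^bsub>even_tree_group k\<^esub> t) = act k s \<otimes>\<^bsub>A\<^esub> act k t"
      using hom_mult[OF act_hom, of s k t] st by (simp add: A_def)
    thus "f (s \<otimes>\<^bsub>even_tree_group k\<^esub> t) = f s \<otimes>\<^bsub>A\<lparr>carrier := P\<rparr>\<^esub> f t"
      using g(1) act[OF st(1)] act[OF st(2)]
      by (simp add: f_def A.m_assoc A.inv_solve_left' flip: A.m_assoc[of "inv\<^bsub>A\<^esub> g" g])
  qed (use bij P A.subgroup_imp_group group_even_tree_group in \<open>auto simp: bij_betw_def\<close>)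
  show ?thesis
    using commutator_width_iso derived_even_tree_group_commutator[of _ l]
      derived_even_tree_group_trivial_iff[of l] bij k
    by (simp add: A_def tree_group_def)
qed

end
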